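(* Let $\mathcal G=\{\mathcal V,\mathcal E\}$ be a simple bi-directed graph on $\mathcal V=\{1,\dots,m\}$ with a clustering $\mathcal C=\{\mathcal C_1,\dots,\mathcal C_K\}$, and let $L=[l_{ij}]_{i,j=1}^m$ be the associated weighted Laplacian (defined in the context). Suppose that the common inter-cluster coupling condition holds, and let $\alpha>0$. Then there exist a positive definite diagonal matrix $D=\mathrm{diag}[d_1,\dots,d_m]$, with $d=[d_1,\dots,d_m]^\top$, and a sufficiently large constant $c>0$ such that $$\big[D(cL+\alpha I_m)\big]^{s}\big|_{\mathcal T^{d}_{\mathcal C}(1)}\le 0$$ if and only if, for each $k=1,\dots,K$, all vertices of the cluster $\mathcal C_k$ belong to the same connected component of $\mathcal G$.
   Context: Graph and clustering: "simple" means no self-loops or multiple edges; "bi-directed" means $e(i,j)\in\mathcal E$ if and only if $e(j,i)\in\mathcal E$. $\mathcal N(i)=\{j\in\mathcal V: e(i,j)\in\mathcal E\}$ is the neighborhood of $i$. A clustering is a partition of $\mathcal V$: $\bigcup_{k=1}^K\mathcal C_k=\mathcal V$ and $\mathcal C_k\cap\mathcal C_l=\emptyset$ for $k\neq l$. Put $\mathcal N_{k}(i)=\mathcal N(i)\cap\mathcal C_{k}$ and $d_{i,k}=\#\mathcal N_k(i)$. A connected component is a maximal set of vertices each of which can reach all the others by paths in $\mathcal G$. Weighted Laplacian $L$: for $i\ne j$, $l_{ij}=1/d_{i,k}$ if $j\in\mathcal N_k(i)$ for some $k\in\{1,\dots,K\}$ (this $k$ is the index of the cluster containing $j$), and $l_{ij}=0$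 otherwise; $l_{ii}=-\sum_{j\ne i}l_{ij}$. Common inter-cluster coupling condition: for $i\in\mathcal C_k$ let $\mathcal L_k^i=\{k': k'\ne k,\ \mathcal N_{k'}(i)\neq\emptyset\}$. The condition is that for every $k=1,\dots,K$, $\mathcal L_k^i=\mathcal L_k^{i'}$ for all $i,i'\in\mathcal C_k$. Transverse space: $\mathcal T^d_{\mathcal C}(1)=\{u=[u^1,\dots,u^m]^\top\in\mathbb R^m:\ \sum_{i\in\mathcal C_k}d_iu^i=0\ \text{for all }k=1,\dots,K\}$. Matrix notation: $Z^s=(Z+Z^\top)/2$, $I_m$ is the identity matrix, and $Z|_V\le 0$ means $u^\top Zu\le 0$ for all $u$ in the linear subspace $V$. *)

theory Defs
  imports "HOL-Analysis.Analysis" "HOL-Library.Disjoint_Sets"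
    "Graph_Theory.Digraph" "Graph_Theory.Digraph_Component"
begin

(* The edge e(i,j) is present iff i \<rightarrow>\<^bsub>G\<^esub> j, that is, (i,j) \<in> arcs_ends G. *)
definition nbhd :: "('m, 'e) pre_digraph \<Rightarrow> 'm \<Rightarrow> 'm set" where
  "nbhd G i = {j \<in> verts G. i \<rightarrow>\<^bsub>G\<^esub> j}"

(* Clusters are C 1, ..., C K. As only covering and disjointness are required,
   some of them may be empty. *)
definition clustering :: "'m set \<Rightarrow> nat \<Rightarrow> (nat \<Rightarrow> 'm set) \<Rightarrow> bool" where
  "clustering V K C \<longleftrightarrow> (\<Union>k\<in>{1..K}. C k) = V \<and> disjoint_family_on C {1..K}"

definition cluster_nbhd :: "('m, 'e) pre_digraph \<Rightarrow> (nat \<Rightarrow> 'm set) \<Rightarrow> nat \<Rightarrow> 'm \<Rightarrow> 'm set" where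
  "cluster_nbhd G C k i = nbhd G i \<inter> C k"

definition cluster_degree :: "('m, 'e) pre_digraph \<Rightarrow> (nat \<Rightarrow> 'm set) \<Rightarrow> 'm \<Rightarrow> nat \<Rightarrow> nat" where
  "cluster_degree G C i k = card (cluster_nbhd G C k i)"

(* For a clustering, the index k in the first branch is unique: it is the
   cluster containing j. *)
definition link_weight :: "('m, 'e) pre_digraph \<Rightarrow> nat \<Rightarrow> (nat \<Rightarrow> 'm set) \<Rightarrow> 'm \<Rightarrow> 'm \<Rightarrow> real" where
  "link_weight G K C i j =
    (if \<exists>k\<in>{1..K}. j \<in> cluster_nbhd G C k i
     then 1 / real (cluster_degree G C i (THE k. k \<in> {1..K} \<and> j \<in> cluster_nbhd G C k i))
     else 0)"

definition weighted_laplacian ::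
    "('m::finite, 'e) pre_digraph \<Rightarrow> nat \<Rightarrow> (nat \<Rightarrow> 'm set) \<Rightarrow> real ^ 'm ^ 'm" where
  "weighted_laplacian G K C =
    (\<chi> i j. if i = j then - (\<Sum>j'\<in>UNIV - {i}. link_weight G K C i j') else link_weight G K C i j)"

definition coupled_clusters ::
    "('m, 'e) pre_digraph \<Rightarrow> nat \<Rightarrow> (nat \<Rightarrow> 'm set) \<Rightarrow> nat \<Rightarrow> 'm \<Rightarrow> nat set" where
  "coupled_clusters G K C k i = {k' \<in> {1..K}. k' \<noteq> k \<and> cluster_nbhd G C k' i \<noteq> {}}"

definition common_inter_cluster_coupling ::
    "('m, 'e) pre_digraph \<Rightarrow> nat \<Rightarrow> (nat \<Rightarrow> 'm set) \<Rightarrow> bool" where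
  "common_inter_cluster_coupling G K C \<longleftrightarrow>
    (\<forall>k\<in>{1..K}. \<forall>i\<in>C k. \<forall>i'\<in>C k. coupled_clusters G K C k i = coupled_clusters G K C k i')"

definition transverse_space :: "nat \<Rightarrow> (nat \<Rightarrow> 'm set) \<Rightarrow> real ^ 'm::finite \<Rightarrow> (real ^ 'm) set" where
  "transverse_space K C d = {u. \<forall>k\<in>{1..K}. (\<Sum>i\<in>C k. d $ i * u $ i) = 0}"

definition diag :: "real ^ 'm::finite \<Rightarrow> real ^ 'm ^ 'm" where
  "diag d = (\<chi> i j. if i = j then d $ i else 0)"

definition pos_def :: "real ^ 'm ^ 'm::finite \<Rightarrow> bool" where
  "pos_def Z \<longleftrightarrow> transpose Z = Z \<and> (\<forall>u. u \<noteq> 0 \<longrightarrow> 0 < u \<bullet> (Z *v u))"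

definition sym_part :: "real ^ 'm ^ 'm::finite \<Rightarrow> real ^ 'm ^ 'm" where
  "sym_part Z = (1/2) *\<^sub>R (Z + transpose Z)"

definition nonpos_on :: "real ^ 'm ^ 'm::finite \<Rightarrow> (real ^ 'm) set \<Rightarrow> bool" where
  "nonpos_on Z V \<longleftrightarrow> (\<forall>u\<in>V. u \<bullet> (Z *v u) \<le> 0)"

lemma inner_sym_part: "u \<bullet> (sym_part Z *v u) = u \<bullet> (Z *v u)"
proof -
  have "u \<bullet> (transpose Z *v u) = u \<bullet> (Z *v u)"
    by (metis dot_lmul_matrix inner_commute transpose_matrix_vector)
  then show ?thesis
    by (simp add: sym_part_def matrix_vector_mult_add_rdistrib inner_add_right
        scaleR_matrix_vector_assoc[symmetric])
qed

(* The inequality is preserved under increasing c, so "some c > 0" and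
   "all sufficiently large c" express the same condition. *)
lemma nonpos_on_coupling_mono:
  fixes L :: "real ^ 'm ^ 'm::finite"
  assumes "pos_def (diag d)" "0 < \<alpha>" "0 < c" "c \<le> c'"
    and "nonpos_on (sym_part (diag d ** (c *\<^sub>R L + \<alpha> *\<^sub>R mat 1))) V"
  shows "nonpos_on (sym_part (diag d ** (c' *\<^sub>R L + \<alpha> *\<^sub>R mat 1))) V"
  unfolding nonpos_on_def inner_sym_part
proof
  fix u assume "u \<in> V"
  let ?q = "u \<bullet> (diag d *v (L *v u))" and ?p = "u \<bullet> (diag d *v u)"
  have form: "u \<bullet> (diag d ** (b *\<^sub>R L + \<alpha> *\<^sub>R mat 1) *v u) = b * ?q + \<alpha> * ?p" for b
    by (simp add: matrix_vector_mul_assoc[symmetric] matrix_vector_mult_add_rdistrib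
        scaleR_matrix_vector_assoc[symmetric] matrix_vector_right_distrib inner_add_right
        matrix_vector_mult_scaleR)
  have "0 \<le> ?p"
    using assms(1) by (cases "u = 0") (auto simp: pos_def_def less_imp_le)
  then have p: "0 \<le> \<alpha> * ?p"
    using assms(2) by simp
  have "u \<bullet> (diag d ** (c *\<^sub>R L + \<alpha> *\<^sub>R mat 1) *v u) \<le> 0"
    using assms(5) \<open>u \<in> V\<close> by (simp add: nonpos_on_def inner_sym_part)
  then have le: "c * ?q + \<alpha> * ?p \<le> 0"
    by (simp only: form)
  then have "c * ?q \<le> 0"
    using p by linarith
  then have "?q \<le> 0"
    using assms(3) by (simp add: mult_le_0_iff)
  then have "c' * ?q \<le> c * ?q"
    using assms(4) by (simp add: mult_right_mono_neg)
  then show "u \<bullet> (diag d ** (c' *\<^sub>R L + \<alpha> *\<^sub>R mat 1) *v u) \<le> 0"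
    using le unfolding form by linarith
qed

end

theory Submission
  imports Defs
begin

text \<open>
  The quadratic form in question is \<open>c q(u) + \<alpha> p(u)\<close> with \<open>q(u) = u\<^sup>T D L u\<close> and
  \<open>p(u) = \<Sum>\<^sub>i d\<^sub>i u\<^sub>i\<^sup>2\<close>, so everything depends on the sign of \<open>q\<close> on the transverse space.
  The matrix \<open>L\<close> has nonnegative off-diagonal entries and vanishing row sums; since the graph is
  bi-directed, the support of \<open>L\<close> is symmetric although \<open>L\<close> itself need not be.

  \<^emph>\<open>Connected clusters suffice.\<close> Take for \<open>d\<close> a positive left null vector of \<open>L\<close>
  (\<open>positive_left_null_vector\<close>), that is, an invariant measure of the Markov chain with rates \<open>L\<close>.
  Then \<open>q(u) = - 1/2 \<Sum> d\<^sub>i l\<^sub>i\<^sub>j (u\<^sub>j - u\<^sub>i)\<^sup>2\<close> (\<open>dissipation_identity\<close>), which is negative unless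
  \<open>u\<close> is constant on connected components. In that case \<open>u\<close> is constant on every cluster, and having
  weighted sum zero there, it vanishes. So \<open>q\<close> is negative definite on the transverse space, and
  by compactness a large multiple of it dominates \<open>\<alpha> p\<close> (\<open>negative_definite_dominates\<close>).

  \<^emph>\<open>Connected clusters are necessary.\<close> Suppose that a connected component \<open>S\<close> cuts a cluster
  into two nonempty parts. Subtract from the indicator vector of \<open>S\<close> its \<open>d\<close>-weighted mean over
  each cluster; the result \<open>u\<close> is transverse and nonzero. The indicator is annihilated by \<open>L\<close>, and
  because of the common inter-cluster coupling \<open>L\<close> maps cluster-constant vectors to cluster-constant
  vectors (\<open>weighted_laplacian_mult_cluster_constant\<close>), so \<open>L u\<close> is constant on clusters. Transverse
  vectors are exactly those orthogonal to the cluster-constant ones in the inner product weighted by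
  \<open>d\<close>; therefore \<open>q(u) = 0\<close>, and the form has the positive value \<open>\<alpha> p(u)\<close> for every \<open>c\<close>.
\<close>

section \<open>Rate matrices\<close>

text \<open>Off-diagonal entries are the transition rates of a continuous-time Markov chain on \<open>'m\<close>.\<close>
definition rate_matrix :: "real ^ 'm ^ 'm::finite \<Rightarrow> bool" where
  "rate_matrix L \<longleftrightarrow> (\<forall>i j. i \<noteq> j \<longrightarrow> 0 \<le> L $ i $ j) \<and> (\<forall>i. (\<Sum>j\<in>UNIV. L $ i $ j) = 0)"

lemma rate_matrix_nonneg: "rate_matrix L \<Longrightarrow> i \<noteq> j \<Longrightarrow> 0 \<le> L $ i $ j"
  by (simp add: rate_matrix_def)

text \<open>Vanishing row sums let \<open>L x\<close> be written through differences of \<open>x\<close>, which is what makes the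
  maximum principle and the dissipation identity visible.\<close>
lemma rate_matrix_mult:
  assumes "rate_matrix L"
  shows "(L *v x) $ i = (\<Sum>j\<in>UNIV. L $ i $ j * (x $ j - x $ i))"
proof -
  have "(\<Sum>j\<in>UNIV. L $ i $ j * x $ i) = 0"
    using assms by (simp add: rate_matrix_def flip: sum_distrib_right)
  then show ?thesis
    by (simp add: matrix_vector_mult_def right_diff_distrib sum_subtractf)
qed

lemma rate_matrix_mult_eq_0:
  assumes "rate_matrix L" and "\<And>j. 0 < L $ i $ j \<Longrightarrow> x $ j = x $ i"
  shows "(L *v x) $ i = 0"
proof -
  have "L $ i $ j * (x $ j - x $ i) = 0" for j
    using assms(2)[of j] rate_matrix_nonneg[OF assms(1), of i j]
    by (cases "j = i") (auto simp: order_less_le)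
  then show ?thesis
    unfolding rate_matrix_mult[OF assms(1)] by (intro sum.neutral) blast
qed

text \<open>A maximum principle. Among the vertices having a neighbour with a different value, one where \<open>x\<close>
  is largest would have no higher neighbour and at least one strictly lower one, making the value
  of \<open>L x\<close> there negative; so no vertex has such a neighbour. This argument treats all connected
  components at once.\<close>
lemma subharmonic_imp_harmonic:
  fixes L :: "real ^ 'm ^ 'm::finite"
  assumes L: "rate_matrix L"
    and sym: "\<And>i j. 0 < L $ i $ j \<longleftrightarrow> 0 < L $ j $ i"
    and sub: "\<And>i. 0 \<le> (L *v x) $ i"
  shows "L *v x = 0"
proof -
  define N where "N = {i. \<exists>j. 0 < L $ i $ j \<and> x $ j \<noteq> x $ i}"
  have "N = {}"
  proof (rule ccontr)
    assume "N \<noteq> {}"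
    then have "Max ((\<lambda>i. x $ i) ` N) \<in> (\<lambda>i. x $ i) ` N"
      by (intro Max_in) auto
    then obtain i where "i \<in> N" and i: "x $ i = Max ((\<lambda>i. x $ i) ` N)"
      by force
    have max: "x $ l \<le> x $ i" if "l \<in> N" for l
      unfolding i using that by (intro Max_ge) auto
    from \<open>i \<in> N\<close> obtain j where j: "0 < L $ i $ j" "x $ j \<noteq> x $ i"
      by (auto simp: N_def)
    \<comment> \<open>Neighbours at which \<open>x\<close> differs lie in \<open>N\<close> again because the support of \<open>L\<close> is
      symmetric, so the value of \<open>x\<close> at \<open>i\<close> is not exceeded at any neighbour.\<close>
    have nbr: "x $ l \<le> x $ i" if "0 < L $ i $ l" for l
    proof (cases "x $ l = x $ i")
      case False
      then have "l \<in> N"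
        using that sym unfolding N_def by (metis (mono_tags, lifting) mem_Collect_eq)
      then show ?thesis
        by (rule max)
    qed simp
    have le: "L $ i $ l * (x $ l - x $ i) \<le> 0" for l
      using L nbr[of l] by (cases "l = i"; cases "L $ i $ l = 0")
        (auto simp: rate_matrix_def order_less_le mult_le_0_iff)
    have "L $ i $ j * (x $ j - x $ i) < 0"
      using j nbr[of j] by (simp add: mult_less_0_iff)
    then have "(\<Sum>l\<in>UNIV. L $ i $ l * (x $ l - x $ i)) < (\<Sum>l\<in>(UNIV::'m set). 0)"
      using le by (intro sum_strict_mono_ex1) auto
    then show False
      using sub[of i] by (simp add: rate_matrix_mult[OF L])
  qed
  then have "(L *v x) $ i = 0" for i
    by (intro rate_matrix_mult_eq_0[OF L]) (auto simp: N_def)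
  then show ?thesis
    by (simp add: vec_eq_iff)
qed

text \<open>The triangle inequality gives \<open>\<bar>z\<bar>\<^sup>T L \<ge> 0\<close> entrywise, and the entries of \<open>\<bar>z\<bar>\<^sup>T L\<close> add up to zero
  because the row sums of \<open>L\<close> vanish.\<close>
lemma left_null_abs:
  fixes L :: "real ^ 'm ^ 'm::finite" and z :: "real ^ 'm"
  assumes L: "rate_matrix L"
    and null: "z v* L = 0"
  shows "(\<chi> i. \<bar>z $ i\<bar>) v* L = 0"
proof -
  define s where "s j = (\<Sum>i\<in>UNIV. \<bar>z $ i\<bar> * L $ i $ j)" for j
  have "0 \<le> s j" for j
  proof -
    have "(\<Sum>i\<in>UNIV. z $ i * L $ i $ j) = 0"
      using null by (simp add: vector_matrix_mult_def vec_eq_iff mult.commute)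
    then have eq: "- (z $ j * L $ j $ j) = (\<Sum>i\<in>UNIV - {j}. z $ i * L $ i $ j)"
      by (simp add: sum.remove[of UNIV j])
    have "L $ j $ j = - (\<Sum>l\<in>UNIV - {j}. L $ j $ l)"
      using L by (simp add: rate_matrix_def sum.remove[of UNIV j] add_eq_0_iff)
    also have "\<dots> \<le> 0"
      unfolding neg_le_0_iff_le by (intro sum_nonneg rate_matrix_nonneg[OF L]) auto
    finally have "L $ j $ j \<le> 0" .
    then have "- (\<bar>z $ j\<bar> * L $ j $ j) = \<bar>- (z $ j * L $ j $ j)\<bar>"
      by (simp add: abs_mult)
    also have "\<dots> \<le> (\<Sum>i\<in>UNIV - {j}. \<bar>z $ i * L $ i $ j\<bar>)"
      unfolding eq by (rule sum_abs)
    also have "\<dots> = (\<Sum>i\<in>UNIV - {j}. \<bar>z $ i\<bar> * L $ i $ j)"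
      using L by (intro sum.cong) (auto simp: rate_matrix_def abs_mult)
    finally show ?thesis
      by (simp add: s_def sum.remove[of UNIV j])
  qed
  moreover have "(\<Sum>j\<in>UNIV. s j) = 0"
    unfolding s_def by (subst sum.swap)
      (use L in \<open>simp add: rate_matrix_def flip: sum_distrib_left\<close>)
  ultimately have "s j = 0" for j
    by (simp add: sum_nonneg_eq_0_iff)
  then show ?thesis
    by (simp add: vec_eq_iff vector_matrix_mult_def s_def mult.commute)
qed

text \<open>If all left null vectors vanished at \<open>i\<close>, the \<open>i\<close>-th unit vector would be in the range of \<open>L\<close>.
  But a preimage of it would be subharmonic, hence harmonic by the maximum principle. Thus the
  component \<open>z\<close> of the unit vector orthogonal to the range is nonzero, and \<open>z\<^sub>i = z \<bullet> z\<close>.\<close>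
lemma left_null_vector_nonzero_at:
  fixes L :: "real ^ 'm ^ 'm::finite"
  assumes L: "rate_matrix L"
    and sym: "\<And>i j. 0 < L $ i $ j \<longleftrightarrow> 0 < L $ j $ i"
  obtains z where "z v* L = 0" and "z $ i \<noteq> 0"
proof -
  let ?R = "range ((*v) L)"
  have sub: "subspace ?R"
    by (intro linear_subspace_image) auto
  obtain y z where "y \<in> span ?R" and orth: "\<And>w. w \<in> span ?R \<Longrightarrow> orthogonal z w"
    and dec: "axis i 1 = y + z"
    using orthogonal_subspace_decomp_exists by metis
  then obtain x where y: "y = L *v x"
    using sub by (auto simp: span_eq_iff[THEN iffD2])
  have "(z v* L) \<bullet> w = 0" for w
    using orth[of "L *v w"] by (simp add: dot_lmul_matrix orthogonal_def span_base)
  then have null: "z v* L = 0"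
    by (metis inner_eq_zero_iff)
  have "z \<noteq> 0"
  proof
    assume "z = 0"
    then have "L *v x = axis i 1"
      using dec y by simp
    moreover from this have "L *v x = 0"
      by (intro subharmonic_imp_harmonic[OF L sym]) (simp add: axis_def)
    ultimately show False
      by simp
  qed
  moreover have "z $ i = z \<bullet> z"
  proof -
    have "z \<bullet> y = 0"
      using orth[of y] \<open>y \<in> span ?R\<close> by (simp add: orthogonal_def)
    moreover have "z \<bullet> axis i 1 = z $ i"
      by (simp add: inner_axis)
    ultimately show ?thesis
      unfolding dec by (simp add: inner_add_right)
  qed
  ultimately show thesis
    using null that by simp
qed

text \<open>Summing over all vertices the absolute values of left null vectors that are nonzero there gives
  positivity everywhere, however many connected components the support has.\<close>
lemma positive_left_null_vector:
  fixes L :: "real ^ 'm ^ 'm::finite"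
  assumes "rate_matrix L"
    and "\<And>i j. 0 < L $ i $ j \<longleftrightarrow> 0 < L $ j $ i"
  obtains d where "\<And>i. 0 < d $ i" and "d v* L = 0"
proof -
  obtain z where z: "\<And>i. z i v* L = 0" "\<And>i. z i $ i \<noteq> 0"
  proof -
    have "\<exists>z. z v* L = 0 \<and> z $ i \<noteq> 0" for i
      using left_null_vector_nonzero_at[OF assms] by metis
    then show thesis
      using that by metis
  qed
  define d where "d = (\<Sum>l\<in>UNIV. \<chi> i. \<bar>z l $ i\<bar>)"
  have "0 < d $ i" for i
  proof -
    have "\<bar>z i $ i\<bar> \<le> (\<Sum>l\<in>UNIV. \<bar>z l $ i\<bar>)"
      by (rule member_le_sum) auto
    then show ?thesis
      using z(2)[of i] by (simp add: d_def)
  qed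
  moreover have "(d v* L) \<bullet> w = 0" for w
    using left_null_abs[OF assms(1) z(1)]
    by (simp add: d_def dot_lmul_matrix inner_sum_left) (simp flip: dot_lmul_matrix)
  ultimately show thesis
    using that by (metis inner_eq_zero_iff)
qed

text \<open>Insert \<open>u\<^sub>i (u\<^sub>j - u\<^sub>i) = (u\<^sub>j\<^sup>2 - u\<^sub>i\<^sup>2 - (u\<^sub>j - u\<^sub>i)\<^sup>2) / 2\<close>: the first two terms contribute the
  pairing of \<open>d\<close> with \<open>L\<close> applied to the vector of squares, which is zero.\<close>
lemma dissipation_identity:
  fixes L :: "real ^ 'm ^ 'm::finite"
  assumes L: "rate_matrix L" and null: "d v* L = 0"
  shows "(\<Sum>i\<in>UNIV. d $ i * u $ i * (L *v u) $ i)
    = - (1/2) * (\<Sum>i\<in>UNIV. \<Sum>j\<in>UNIV. d $ i * L $ i $ j * (u $ j - u $ i)\<^sup>2)"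
proof -
  let ?sq = "\<chi> i. (u $ i)\<^sup>2"
  have "d \<bullet> (L *v ?sq) = 0"
    using null by (simp flip: dot_lmul_matrix)
  then have 0: "(\<Sum>i\<in>UNIV. \<Sum>j\<in>UNIV. d $ i * L $ i $ j * ((u $ j)\<^sup>2 - (u $ i)\<^sup>2)) = 0"
    by (simp add: inner_vec_def rate_matrix_mult[OF L] sum_distrib_left mult.assoc)
  have "(\<Sum>i\<in>UNIV. d $ i * u $ i * (L *v u) $ i)
      = (\<Sum>i\<in>UNIV. \<Sum>j\<in>UNIV. d $ i * L $ i $ j * (u $ i * (u $ j - u $ i)))"
    by (simp add: rate_matrix_mult[OF L] sum_distrib_left mult_ac)
  also have "\<dots> = (\<Sum>i\<in>UNIV. \<Sum>j\<in>UNIV.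
      1/2 * (d $ i * L $ i $ j * ((u $ j)\<^sup>2 - (u $ i)\<^sup>2))
      - 1/2 * (d $ i * L $ i $ j * (u $ j - u $ i)\<^sup>2))"
    by (intro sum.cong refl) (simp add: power2_eq_square algebra_simps)
  also have "\<dots> = - (1/2) * (\<Sum>i\<in>UNIV. \<Sum>j\<in>UNIV. d $ i * L $ i $ j * (u $ j - u $ i)\<^sup>2)"
    by (simp only: sum_subtractf 0 flip: sum_distrib_left)
  finally show ?thesis .
qed

lemma dissipative:
  fixes L :: "real ^ 'm ^ 'm::finite"
  assumes L: "rate_matrix L" and null: "d v* L = 0" and pos: "\<And>i. 0 < d $ i"
  shows "(\<Sum>i\<in>UNIV. d $ i * u $ i * (L *v u) $ i) \<le> 0"
    and "(\<Sum>i\<in>UNIV. d $ i * u $ i * (L *v u) $ i) = 0 \<Longrightarrow> 0 < L $ i $ j \<Longrightarrow> u $ j = u $ i"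
proof -
  have nonneg: "0 \<le> d $ i * L $ i $ j * (u $ j - u $ i)\<^sup>2" for i j
    using L pos[of i] by (cases "i = j") (auto simp: rate_matrix_def order_less_le)
  then have "0 \<le> (\<Sum>i\<in>UNIV. \<Sum>j\<in>UNIV. d $ i * L $ i $ j * (u $ j - u $ i)\<^sup>2)"
    by (intro sum_nonneg)
  then show "(\<Sum>i\<in>UNIV. d $ i * u $ i * (L *v u) $ i) \<le> 0"
    unfolding dissipation_identity[OF L null] by linarith
  assume 0: "(\<Sum>i\<in>UNIV. d $ i * u $ i * (L *v u) $ i) = 0" and "0 < L $ i $ j"
  have "(\<Sum>i\<in>UNIV. \<Sum>j\<in>UNIV. d $ i * L $ i $ j * (u $ j - u $ i)\<^sup>2) = 0"
    using 0 unfolding dissipation_identity[OF L null] by linarith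
  then have "d $ i * L $ i $ j * (u $ j - u $ i)\<^sup>2 = 0"
    using nonneg by (metis (no_types, lifting) finite sum_nonneg sum_nonneg_eq_0_iff UNIV_I)
  then show "u $ j = u $ i"
    using pos[of i] \<open>0 < L $ i $ j\<close> by auto
qed

section \<open>Quadratic forms\<close>

lemma diag_mult: "(diag d *v u) $ i = d $ i * u $ i"
  by (simp add: diag_def matrix_vector_mult_def if_distrib[of "\<lambda>x. x * _"] cong: if_cong)

lemma pos_def_diag: "pos_def (diag d) \<longleftrightarrow> (\<forall>i. 0 < d $ i)"
proof -
  have form: "u \<bullet> (diag d *v u) = (\<Sum>i\<in>UNIV. d $ i * (u $ i)\<^sup>2)" for u
    by (simp add: inner_vec_def diag_mult power2_eq_square mult_ac)
  have "transpose (diag d) = diag d"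
    by (auto simp: diag_def transpose_def vec_eq_iff)
  moreover have "0 < d $ i" if "\<And>u. u \<noteq> 0 \<Longrightarrow> 0 < u \<bullet> (diag d *v u)" for i
    using that[of "axis i 1"] by (simp add: inner_axis' diag_mult)
  moreover have "0 < u \<bullet> (diag d *v u)" if d: "\<And>i. 0 < d $ i" and "u \<noteq> 0" for u
  proof -
    obtain i where "u $ i \<noteq> 0"
      using \<open>u \<noteq> 0\<close> by (auto simp: vec_eq_iff)
    then show ?thesis
      unfolding form using d by (intro sum_pos2[of UNIV i]) (auto simp: less_imp_le)
  qed
  ultimately show ?thesis
    unfolding pos_def_def by blast
qed

lemma quadratic_form_split:
  "u \<bullet> (sym_part (diag d ** (c *\<^sub>R L + \<alpha> *\<^sub>R mat 1)) *v u)
    = c * (\<Sum>i\<in>UNIV. d $ i * u $ i * (L *v u) $ i) + \<alpha> * (\<Sum>i\<in>UNIV. d $ i * (u $ i)\<^sup>2)"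
proof -
  have "u \<bullet> (diag d *v v) = (\<Sum>i\<in>UNIV. d $ i * u $ i * v $ i)" for v
    by (simp add: inner_vec_def diag_mult mult_ac)
  then show ?thesis
    by (simp add: inner_sym_part matrix_vector_mul_assoc[symmetric] matrix_vector_mult_add_rdistrib
        scaleR_matrix_vector_assoc[symmetric] matrix_vector_right_distrib inner_add_right
        matrix_vector_mult_scaleR power2_eq_square mult.assoc)
qed

text \<open>The ratio of \<open>p\<close> to \<open>-q\<close> is homogeneous of degree zero and continuous on the unit sphere of \<open>V\<close>,
  hence bounded by compactness; any positive bound serves as \<open>c\<close>.\<close>
lemma negative_definite_dominates:
  fixes V :: "(real ^ 'm::finite) set" and q p :: "real ^ 'm \<Rightarrow> real"
  assumes V: "subspace V"
    and cont: "continuous_on UNIV q" "continuous_on UNIV p"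
    and homq: "\<And>t u. q (t *\<^sub>R u) = t\<^sup>2 * q u"
    and homp: "\<And>t u. p (t *\<^sub>R u) = t\<^sup>2 * p u"
    and neg: "\<And>u. u \<in> V \<Longrightarrow> u \<noteq> 0 \<Longrightarrow> q u < 0"
  obtains c where "0 < c" and "\<And>u. u \<in> V \<Longrightarrow> c * q u + p u \<le> 0"
proof -
  let ?S = "sphere 0 1 \<inter> V"
  have compact: "compact ?S"
    using V by (intro compact_Int_closed closed_subspace) auto
  have "continuous_on ?S (\<lambda>u. p u / - q u)"
    using neg by (intro continuous_intros continuous_on_subset[OF cont(1)]
        continuous_on_subset[OF cont(2)]) force+
  then have "bdd_above ((\<lambda>u. p u / - q u) ` ?S)"
    using compact by (intro bounded_imp_bdd_above compact_imp_bounded compact_continuous_image)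
  then obtain M where M: "\<And>u. u \<in> ?S \<Longrightarrow> p u / - q u \<le> M"
    unfolding bdd_above_def by blast
  let ?c = "max 1 M"
  have "?c * q u + p u \<le> 0" if "u \<in> V" for u
  proof (cases "u = 0")
    case True
    then show ?thesis
      using homq[of 0 u] homp[of 0 u] by simp
  next
    case False
    let ?v = "(1 / norm u) *\<^sub>R u"
    have v: "?v \<in> ?S"
      using V that False by (auto intro: subspace_scale)
    then have "q ?v < 0"
      using neg[of ?v] by force
    moreover have "p ?v / - q ?v \<le> ?c"
      using M[OF v] by linarith
    ultimately have "p ?v \<le> ?c * - q ?v"
      using pos_divide_le_eq[of "- q ?v" "p ?v" ?c] by linarith
    then have "?c * q ?v + p ?v \<le> 0"
      by simp
    moreover have "?c * q u + p u = (norm u)\<^sup>2 * (?c * q ?v + p ?v)"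
      unfolding homq homp using False by (simp add: field_simps)
    ultimately show ?thesis
      by (simp add: mult_nonneg_nonpos)
  qed
  then show thesis
    by (intro that[of ?c]) auto
qed

section \<open>The weighted Laplacian of a clustered graph\<close>

lemma clustering_index_unique:
  assumes "clustering V K C" "k \<in> {1..K}" "k' \<in> {1..K}" "j \<in> C k" "j \<in> C k'"
  shows "k = k'"
  using assms unfolding clustering_def disjoint_family_on_def by blast

lemma link_weight_in_cluster:
  assumes C: "clustering V K C" and "k \<in> {1..K}" "j \<in> C k"
  shows "link_weight G K C i j =
    (if j \<in> cluster_nbhd G C k i then 1 / real (cluster_degree G C i k) else 0)"
proof -
  have uniq: "l = k" if "l \<in> {1..K}" "j \<in> cluster_nbhd G C l i" for l
    using clustering_index_unique[OF C that(1) assms(2)] that(2) assms(3)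
    by (auto simp: cluster_nbhd_def)
  show ?thesis
  proof (cases "j \<in> cluster_nbhd G C k i")
    case True
    then have "(THE l. l \<in> {1..K} \<and> j \<in> cluster_nbhd G C l i) = k"
      using uniq assms(2) by (intro the_equality) blast+
    moreover have "\<exists>l\<in>{1..K}. j \<in> cluster_nbhd G C l i"
      using True assms(2) by blast
    ultimately show ?thesis
      using True by (simp add: link_weight_def)
  next
    case False
    then have "\<not> (\<exists>l\<in>{1..K}. j \<in> cluster_nbhd G C l i)"
      using uniq by blast
    then show ?thesis
      using False by (simp add: link_weight_def)
  qed
qed

lemma link_weight_nonneg: "0 \<le> link_weight G K C i j"
  by (simp add: link_weight_def)

lemma link_weight_pos_iff:
  fixes C :: "nat \<Rightarrow> 'm::finite set"
  assumes C: "clustering (verts G) K C" and "verts G = UNIV"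
  shows "0 < link_weight G K C i j \<longleftrightarrow> i \<rightarrow>\<^bsub>G\<^esub> j"
proof -
  obtain k where "k \<in> {1..K}" "j \<in> C k"
    using assms unfolding clustering_def by blast
  moreover have "0 < cluster_degree G C i k" if "j \<in> cluster_nbhd G C k i"
    using that by (auto simp: cluster_degree_def card_gt_0_iff)
  ultimately show ?thesis
    using assms(2) by (auto simp: link_weight_in_cluster[OF C] cluster_nbhd_def nbhd_def)
qed

text \<open>The normalisation of the weights makes the total pull of a cluster on a vertex depend only on
  whether the two are linked at all. This is why \<open>L\<close> is compatible with the clustering.\<close>
lemma sum_link_weight_cluster:
  fixes C :: "nat \<Rightarrow> 'm::finite set"
  assumes "clustering V K C" "k \<in> {1..K}"
  shows "(\<Sum>j\<in>C k. link_weight G K C i j) = (if cluster_nbhd G C k i = {} then 0 else 1)"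
proof -
  have "(\<Sum>j\<in>C k. link_weight G K C i j)
      = (\<Sum>j\<in>C k. if j \<in> cluster_nbhd G C k i then 1 / real (cluster_degree G C i k) else 0)"
    using assms by (intro sum.cong) (auto simp: link_weight_in_cluster)
  also have "\<dots> = (\<Sum>j\<in>cluster_nbhd G C k i. 1 / real (cluster_degree G C i k))"
    by (intro sum.mono_neutral_cong_right) (auto simp: cluster_nbhd_def)
  finally show ?thesis
    by (simp add: cluster_degree_def)
qed

lemma weighted_laplacian_off_diagonal:
  "i \<noteq> j \<Longrightarrow> weighted_laplacian G K C $ i $ j = link_weight G K C i j"
  by (simp add: weighted_laplacian_def)

lemma rate_matrix_weighted_laplacian: "rate_matrix (weighted_laplacian G K C)"
  unfolding rate_matrix_def
proof (intro conjI allI impI)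
  show "0 \<le> weighted_laplacian G K C $ i $ j" if "i \<noteq> j" for i j
    using that by (simp add: weighted_laplacian_off_diagonal link_weight_nonneg)
  show "(\<Sum>j\<in>UNIV. weighted_laplacian G K C $ i $ j) = 0" for i
  proof -
    have "(\<Sum>j\<in>UNIV - {i}. weighted_laplacian G K C $ i $ j)
        = (\<Sum>j\<in>UNIV - {i}. link_weight G K C i j)"
      by (intro sum.cong) (auto simp: weighted_laplacian_off_diagonal)
    moreover have "weighted_laplacian G K C $ i $ i = - (\<Sum>j\<in>UNIV - {i}. link_weight G K C i j)"
      by (simp add: weighted_laplacian_def)
    ultimately show ?thesis
      by (simp add: sum.remove[of UNIV i])
  qed
qed

lemma weighted_laplacian_mult:
  "(weighted_laplacian G K C *v x) $ i = (\<Sum>j\<in>UNIV. link_weight G K C i j * (x $ j - x $ i))"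
  unfolding rate_matrix_mult[OF rate_matrix_weighted_laplacian]
  by (intro sum.cong refl) (auto simp: weighted_laplacian_def)

lemma weighted_laplacian_pos_iff:
  assumes "graph G" "verts G = UNIV" "clustering (verts G) K C"
  shows "0 < weighted_laplacian G K C $ i $ j \<longleftrightarrow> i \<rightarrow>\<^bsub>G\<^esub> j"
proof (cases "i = j")
  case True
  interpret graph G by fact
  have "\<not> i \<rightarrow>\<^bsub>G\<^esub> i"
    using no_loops unfolding arcs_ends_conv by fastforce
  moreover have "weighted_laplacian G K C $ i $ i \<le> 0"
    by (simp add: weighted_laplacian_def link_weight_nonneg sum_nonneg)
  ultimately show ?thesis
    using True by simp
next
  case False
  then show ?thesis
    using link_weight_pos_iff[OF assms(3,2)] by (simp add: weighted_laplacian_off_diagonal)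
qed

lemma sum_clusters:
  fixes C :: "nat \<Rightarrow> 'm::finite set" and f :: "'m \<Rightarrow> real"
  assumes "clustering UNIV K C"
  shows "(\<Sum>i\<in>UNIV. f i) = (\<Sum>k\<in>{1..K}. \<Sum>i\<in>C k. f i)"
  using assms sum.UNION_disjoint[of "{1..K}" C f]
  by (simp add: clustering_def disjoint_family_on_def)

text \<open>On cluster-constant vectors \<open>L\<close> acts through the graph of clusters: the vertex \<open>i\<close> enters only by
  the set of clusters to which it is coupled. Under common inter-cluster coupling the value is thus
  the same for all \<open>i\<close> in a cluster.\<close>
lemma weighted_laplacian_mult_cluster_constant:
  fixes C :: "nat \<Rightarrow> 'm::finite set"
  assumes C: "clustering UNIV K C"
    and x: "\<And>k i. k \<in> {1..K} \<Longrightarrow> i \<in> C k \<Longrightarrow> x $ i = m k"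
    and i: "k \<in> {1..K}" "i \<in> C k"
  shows "(weighted_laplacian G K C *v x) $ i = (\<Sum>l\<in>coupled_clusters G K C k i. m l - m k)"
proof -
  have "(weighted_laplacian G K C *v x) $ i
      = (\<Sum>l\<in>{1..K}. \<Sum>j\<in>C l. link_weight G K C i j * (m l - m k))"
    unfolding weighted_laplacian_mult sum_clusters[OF C] using x i by (intro sum.cong) auto
  also have "\<dots> = (\<Sum>l\<in>{1..K}. (if cluster_nbhd G C l i = {} then 0 else 1) * (m l - m k))"
    by (intro sum.cong refl) (simp add: sum_link_weight_cluster[OF C] flip: sum_distrib_right)
  also have "\<dots> = (\<Sum>l\<in>coupled_clusters G K C k i. m l - m k)"
    by (intro sum.mono_neutral_cong_right) (auto simp: coupled_clusters_def)
  finally show ?thesis .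
qed

text \<open>Here \<open>u\<close> differs from a null vector of \<open>L\<close> by a cluster-constant vector. So \<open>L u\<close> is constant on
  clusters, and transversality of \<open>u\<close> annihilates the sum over each cluster.\<close>
lemma transverse_part_of_harmonic_form_zero:
  fixes C :: "nat \<Rightarrow> 'm::finite set" and d x :: "real ^ 'm"
  assumes C: "clustering UNIV K C"
    and coupling: "common_inter_cluster_coupling G K C"
    and x: "weighted_laplacian G K C *v x = 0"
    and u: "u \<in> transverse_space K C d"
    and diff: "\<And>k i. k \<in> {1..K} \<Longrightarrow> i \<in> C k \<Longrightarrow> x $ i - u $ i = m k"
  shows "(\<Sum>i\<in>UNIV. d $ i * u $ i * (weighted_laplacian G K C *v u) $ i) = 0"
proof -
  let ?L = "weighted_laplacian G K C"
  have Lu: "(?L *v u) $ i = - (?L *v (x - u)) $ i" for i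
    using x by (simp add: matrix_vector_mult_diff_distrib)
  have Lm: "(?L *v (x - u)) $ i = (\<Sum>l\<in>coupled_clusters G K C k i. m l - m k)"
    if "k \<in> {1..K}" "i \<in> C k" for k i
    by (rule weighted_laplacian_mult_cluster_constant[OF C _ that]) (simp add: diff)
  have "(\<Sum>i\<in>C k. d $ i * u $ i * (?L *v u) $ i) = 0" if k: "k \<in> {1..K}" for k
  proof (cases "C k = {}")
    case False
    then obtain a where a: "a \<in> C k"
      by blast
    have eq: "(?L *v u) $ i = (?L *v u) $ a" if "i \<in> C k" for i
    proof -
      have "coupled_clusters G K C k i = coupled_clusters G K C k a"
        using coupling k a that unfolding common_inter_cluster_coupling_def by blast
      then show ?thesis
        unfolding Lu Lm[OF k that] Lm[OF k a] by simp
    qed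
    have "(\<Sum>i\<in>C k. d $ i * u $ i * (?L *v u) $ i)
        = (\<Sum>i\<in>C k. d $ i * u $ i) * (?L *v u) $ a"
      unfolding sum_distrib_right by (intro sum.cong refl) (simp only: eq)
    then show ?thesis
      using u k by (simp add: transverse_space_def)
  qed simp
  then show ?thesis
    unfolding sum_clusters[OF C] by simp
qed

section \<open>The equivalence\<close>

lemma subspace_transverse_space: "subspace (transverse_space K C d)"
  by (auto simp: subspace_def transverse_space_def distrib_left sum.distrib
      mult.left_commute simp flip: sum_distrib_left)

lemma connected_clusters_imp_negative:
  fixes G :: "('m::finite, 'e) pre_digraph"
  assumes G: "graph G" and V: "verts G = UNIV" and C: "clustering (verts G) K C"
    and conn: "\<forall>k\<in>{1..K}. \<exists>S \<in> pre_digraph.sccs_verts G. C k \<subseteq> S"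
  obtains d c where "pos_def (diag d)" and "0 < c"
    and "nonpos_on (sym_part (diag d ** (c *\<^sub>R weighted_laplacian G K C + \<alpha> *\<^sub>R mat 1)))
      (transverse_space K C d)"
proof -
  interpret graph G by fact
  let ?L = "weighted_laplacian G K C"
  note L = rate_matrix_weighted_laplacian[of G K C] and pos_iff = weighted_laplacian_pos_iff[OF G V C]
  have "0 < ?L $ i $ j \<longleftrightarrow> 0 < ?L $ j $ i" for i j
    unfolding pos_iff using sym_arcs by (auto dest: arcs_ends_symmetric)
  then obtain d where d: "\<And>i. 0 < d $ i" and null: "d v* ?L = 0"
    using positive_left_null_vector[OF L] by metis
  define q where "q u = (\<Sum>i\<in>UNIV. d $ i * u $ i * (?L *v u) $ i)" for u
  define p where "p u = \<alpha> * (\<Sum>i\<in>UNIV. d $ i * (u $ i)\<^sup>2)" for u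
  have "q u < 0" if u: "u \<in> transverse_space K C d" and "u \<noteq> 0" for u
  proof -
    have "u = 0" if "q u = 0"
    proof -
      have edge: "u $ j = u $ i" if "i \<rightarrow>\<^bsub>G\<^esub> j" for i j
        using dissipative(2)[OF L null d, of u i j] \<open>q u = 0\<close> that unfolding q_def pos_iff by blast
      have reach: "u $ j = u $ i" if "i \<rightarrow>\<^sup>*\<^bsub>G\<^esub> j" for i j
        using that
      proof (induction rule: reachable_induct)
        case (step j l)
        then show ?case
          using edge[of j l] by simp
      qed simp
      have "u $ a = 0" for a
      proof -
        obtain k where k: "k \<in> {1..K}" "a \<in> C k"
          using C V unfolding clustering_def by blast
        have "u $ i = u $ a" if "i \<in> C k" for i
        proof -
          obtain S where "S \<in> sccs_verts" "C k \<subseteq> S"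
            using conn k(1) by blast
          then have "a \<rightarrow>\<^sup>*\<^bsub>G\<^esub> i"
            using that k(2) unfolding sccs_verts_def by blast
          then show ?thesis
            by (rule reach)
        qed
        then have "(\<Sum>i\<in>C k. d $ i * u $ i) = (\<Sum>i\<in>C k. d $ i) * u $ a"
          unfolding sum_distrib_right by (intro sum.cong refl arg_cong2[where f = "(*)"]) blast
        moreover have "0 < (\<Sum>i\<in>C k. d $ i)"
          using d k by (intro sum_pos) auto
        ultimately show ?thesis
          using u k by (auto simp: transverse_space_def)
      qed
      then show ?thesis
        by (simp add: vec_eq_iff)
    qed
    then show ?thesis
      using dissipative(1)[OF L null d, of u] \<open>u \<noteq> 0\<close> by (force simp: q_def)
  qed
  moreover have "continuous_on UNIV q" "continuous_on UNIV p"
    unfolding q_def p_def by (intro continuous_intros)+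
  moreover have "q (t *\<^sub>R u) = t\<^sup>2 * q u" "p (t *\<^sub>R u) = t\<^sup>2 * p u" for t u
    by (simp_all add: q_def p_def matrix_vector_mult_scaleR sum_distrib_left power2_eq_square mult_ac)
  ultimately obtain c where "0 < c" "\<And>u. u \<in> transverse_space K C d \<Longrightarrow> c * q u + p u \<le> 0"
    using negative_definite_dominates[OF subspace_transverse_space] by metis
  then show thesis
    using d by (intro that[of d c])
      (auto simp: pos_def_diag nonpos_on_def quadratic_form_split q_def p_def)
qed

lemma negative_imp_connected_clusters:
  fixes G :: "('m::finite, 'e) pre_digraph"
  assumes G: "graph G" and V: "verts G = UNIV" and C: "clustering (verts G) K C"
    and coupling: "common_inter_cluster_coupling G K C" and "0 < \<alpha>"
    and d: "pos_def (diag d)"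
    and nonpos: "nonpos_on (sym_part (diag d ** (c *\<^sub>R weighted_laplacian G K C + \<alpha> *\<^sub>R mat 1)))
      (transverse_space K C d)"
    and k: "k \<in> {1..K}"
  shows "\<exists>S \<in> pre_digraph.sccs_verts G. C k \<subseteq> S"
proof -
  interpret graph G by fact
  let ?L = "weighted_laplacian G K C"
  \<comment> \<open>For an empty cluster any component will do, hence the unspecified vertex.\<close>
  define a where "a = (SOME a. C k \<noteq> {} \<longrightarrow> a \<in> C k)"
  have a: "a \<in> C k" if "C k \<noteq> {}"
    using that someI_ex[of "\<lambda>a. C k \<noteq> {} \<longrightarrow> a \<in> C k"] by (auto simp: a_def)
  define S where "S = scc_of a"
  define x :: "real ^ 'm" where "x = (\<chi> i. if i \<in> S then 1 else 0)"
  define m where "m l = (\<Sum>i\<in>C l. d $ i * x $ i) / (\<Sum>i\<in>C l. d $ i)" for l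
  define u :: "real ^ 'm" where
    "u = (\<chi> i. x $ i - m (THE l. l \<in> {1..K} \<and> i \<in> C l))"
  have dpos: "0 < d $ i" for i
    using d by (simp add: pos_def_diag)
  have closed: "j \<in> S \<longleftrightarrow> i \<in> S" if "i \<rightarrow>\<^bsub>G\<^esub> j" for i j
    using that arcs_ends_symmetric[OF sym_arcs that] unfolding S_def scc_of_def
    by (auto intro: reachable_adj_trans adj_reachable_trans)
  have "(?L *v x) $ i = 0" for i
  proof (rule rate_matrix_mult_eq_0[OF rate_matrix_weighted_laplacian])
    show "x $ j = x $ i" if "0 < ?L $ i $ j" for j
      using closed[of i j] that unfolding weighted_laplacian_pos_iff[OF G V C] by (simp add: x_def)
  qed
  then have x: "?L *v x = 0"
    by (simp add: vec_eq_iff)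
  have u: "u $ i = x $ i - m l" if "l \<in> {1..K}" "i \<in> C l" for l i
  proof -
    have "(THE l. l \<in> {1..K} \<and> i \<in> C l) = l"
      using that clustering_index_unique[OF C] by (intro the_equality) auto
    then show ?thesis
      by (simp add: u_def)
  qed
  have trans: "u \<in> transverse_space K C d"
    unfolding transverse_space_def
  proof clarify
    fix l assume l: "l \<in> {1..K}"
    show "(\<Sum>i\<in>C l. d $ i * u $ i) = 0"
    proof (cases "C l = {}")
      case False
      then have "0 < (\<Sum>i\<in>C l. d $ i)"
        using dpos by (intro sum_pos) auto
      then have "(\<Sum>i\<in>C l. d $ i) * m l = (\<Sum>i\<in>C l. d $ i * x $ i)"
        by (simp add: m_def)
      moreover have "(\<Sum>i\<in>C l. d $ i * u $ i) = (\<Sum>i\<in>C l. d $ i * (x $ i - m l))"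
        by (intro sum.cong refl arg_cong2[where f = "(*)"] u[OF l])
      ultimately show ?thesis
        by (simp only: right_diff_distrib sum_subtractf sum_distrib_right diff_self)
    qed simp
  qed
  have "(\<Sum>i\<in>UNIV. d $ i * u $ i * (?L *v u) $ i) = 0"
  proof (rule transverse_part_of_harmonic_form_zero[OF _ coupling x trans])
    show "clustering UNIV K C"
      using C V by simp
    show "x $ i - u $ i = m l" if "l \<in> {1..K}" "i \<in> C l" for l i
      using u[OF that] by simp
  qed
  then have "\<alpha> * (\<Sum>i\<in>UNIV. d $ i * (u $ i)\<^sup>2) \<le> 0"
    using nonpos trans by (auto simp: nonpos_on_def quadratic_form_split)
  then have "(\<Sum>i\<in>UNIV. d $ i * (u $ i)\<^sup>2) \<le> 0"
    using \<open>0 < \<alpha>\<close> by (simp add: mult_le_0_iff)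
  moreover have "0 \<le> d $ i * (u $ i)\<^sup>2" for i
    using dpos[of i] by simp
  ultimately have "d $ i * (u $ i)\<^sup>2 = 0" for i
    by (meson antisym finite sum_nonneg sum_nonneg_eq_0_iff UNIV_I)
  then have "u $ i = 0" for i
    using dpos[of i] by (metis less_irrefl mult_eq_0_iff zero_eq_power2)
  then have eq: "x $ i = x $ a" if "i \<in> C k" for i
    using u[OF k that] u[OF k, of a] a that by fastforce
  have "a \<in> S"
    unfolding S_def using V by (intro in_scc_of_self) simp
  then have "C k \<subseteq> S"
    using eq unfolding x_def by (metis (mono_tags) subsetI vec_lambda_beta zero_neq_one)
  moreover have "S \<in> sccs_verts"
    unfolding S_def using V by (intro scc_of_in_sccs_verts) simp
  ultimately show ?thesis
    by blast
qed

theorem theorem2: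
  fixes G :: "('m::finite, 'e) pre_digraph"
    and K :: nat
    and C :: "nat \<Rightarrow> 'm set"
    and \<alpha> :: real
  assumes "graph G"
    and "verts G = UNIV"
    and "clustering (verts G) K C"
    and "common_inter_cluster_coupling G K C"
    and "0 < \<alpha>"
  shows "(\<exists>(d :: real ^ 'm) c. pos_def (diag d) \<and> 0 < c \<and>
            nonpos_on
              (sym_part (diag d ** (c *\<^sub>R weighted_laplacian G K C + \<alpha> *\<^sub>R mat 1)))
              (transverse_space K C d))
         \<longleftrightarrow> (\<forall>k\<in>{1..K}. \<exists>S \<in> pre_digraph.sccs_verts G. C k \<subseteq> S)"
  using negative_imp_connected_clusters[OF assms]
    connected_clusters_imp_negative[OF assms(1-3), of \<alpha>] by metis

end
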